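(* Suppose that $G$ is a left-orderable group with generators $\{g_i\}_{i\in I}$, and that for each $i\in I$ there exists $P_i\in\mathrm{LO}(G)$ which is the positive cone of a discrete left-ordering with $g_i$ as smallest positive element. Then $\mathrm{Aut}(G)$ acts faithfully on $\mathrm{LO}(G)$.
   Context: A left-ordering of a group $G$ is a strict total ordering $<$ of $G$ such that $g<h$ implies $fg<fh$ for all $f,g,h\in G$; $G$ is left-orderable if it admits one. A left-ordering is identified with its positive cone $P=\{g\in G\mid g>1\}$; the positive cones are exactly the subsets $P\subset G$ with $P\cdot P\subset P$ and $G=P\sqcup P^{-1}\sqcup\{1\}$. $\mathrm{LO}(G)$ denotes the set of all positive cones of left-orderings of $G$, and $\mathrm{Aut}(G)$ acts on $\mathrm{LO}(G)$ by $P\mapsto\phi(P)$ for $\phi\in\mathrm{Aut}(G)$. A left-ordering is discrete if it has a smallest positive element, i.e. its positive cone has a least element with respect to the ordering. *)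

theory Defs
  imports "HOL-Algebra.Generated_Groups" "HOL-Algebra.Group_Action"
begin

definition left_ordering :: "('a, 'b) monoid_scheme \<Rightarrow> ('a \<times> 'a) set \<Rightarrow> bool"
  where "left_ordering G r \<longleftrightarrow>
    r \<subseteq> carrier G \<times> carrier G \<and>
    strict_linear_order_on (carrier G) r \<and>
    (\<forall>f\<in>carrier G. \<forall>g\<in>carrier G. \<forall>h\<in>carrier G.
        (g, h) \<in> r \<longrightarrow> (f \<otimes>\<^bsub>G\<^esub> g, f \<otimes>\<^bsub>G\<^esub> h) \<in> r)"

definition left_orderable :: "('a, 'b) monoid_scheme \<Rightarrow> bool"
  where "left_orderable G \<longleftrightarrow> (\<exists>r. left_ordering G r)"

definition positive_cone :: "('a, 'b) monoid_scheme \<Rightarrow> ('a \<times> 'a) set \<Rightarrow> 'a set"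
  where "positive_cone G r = {g \<in> carrier G. (\<one>\<^bsub>G\<^esub>, g) \<in> r}"

definition LO :: "('a, 'b) monoid_scheme \<Rightarrow> 'a set set"
  where "LO G = {positive_cone G r | r. left_ordering G r}"

definition smallest_positive :: "('a, 'b) monoid_scheme \<Rightarrow> ('a \<times> 'a) set \<Rightarrow> 'a \<Rightarrow> bool"
  where "smallest_positive G r g \<longleftrightarrow>
    g \<in> positive_cone G r \<and> (\<forall>h\<in>positive_cone G r. h = g \<or> (g, h) \<in> r)"

definition discrete_left_ordering :: "('a, 'b) monoid_scheme \<Rightarrow> ('a \<times> 'a) set \<Rightarrow> bool"
  where "discrete_left_ordering G r \<longleftrightarrow>
    left_ordering G r \<and> (\<exists>g. smallest_positive G r g)"

text \<open>The restriction to \<^term>\<open>LO G\<close> is needed because \<^const>\<open>BijGroup\<close>, the target of an action in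
  \<^locale>\<open>group_action\<close>, contains only extensional functions.\<close>

definition LO_action :: "('a, 'b) monoid_scheme \<Rightarrow> ('a \<Rightarrow> 'a) \<Rightarrow> 'a set \<Rightarrow> 'a set"
  where "LO_action G \<phi> = (\<lambda>P\<in>LO G. \<phi> ` P)"

text \<open>Positive cones of left-orderings are exactly the subsets \<open>P\<close> with \<open>P P \<subseteq> P\<close> such that the group
  is the disjoint union of \<open>P\<close>, its inverse, and the identity.\<close>

lemma (in group) mem_LO_iff:
  "P \<in> LO G \<longleftrightarrow>
    P \<subseteq> carrier G \<and> P <#> P \<subseteq> P \<and>
    P \<union> set_inv P \<union> {\<one>} = carrier G \<and>
    P \<inter> set_inv P = {} \<and> \<one> \<notin> P \<and> \<one> \<notin> set_inv P"
proof
  assume "P \<in> LO G"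
  then obtain r where r: "left_ordering G r" and P: "P = positive_cone G r"
    unfolding LO_def by blast
  have tr: "trans r" and ir: "irrefl r" and tot: "total_on (carrier G) r"
    using r unfolding left_ordering_def strict_linear_order_on_def by auto
  have left: "(f \<otimes> g, f \<otimes> h) \<in> r"
    if "f \<in> carrier G" "g \<in> carrier G" "h \<in> carrier G" "(g, h) \<in> r" for f g h
    using r that unfolding left_ordering_def by blast
  have mem: "x \<in> P \<longleftrightarrow> x \<in> carrier G \<and> (\<one>, x) \<in> r" for x
    unfolding P positive_cone_def by auto
  have inv_mem: "inv x \<in> P \<longleftrightarrow> (x, \<one>) \<in> r" if "x \<in> carrier G" for x
    using left[of x \<one> "inv x"] left[of "inv x" x \<one>] that by (auto simp: mem)
  have tot_one: "(x, \<one>) \<in> r \<or> (\<one>, x) \<in> r" if "x \<in> carrier G" "x \<noteq> \<one>" for x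
    using tot one_closed that unfolding total_on_def by blast
  have one: "\<one> \<notin> P"
    using ir by (auto simp: mem irrefl_def)
  have mult: "x \<otimes> y \<in> P" if "x \<in> P" "y \<in> P" for x y
    using left[of x \<one> y] that transD[OF tr, of \<one> x "x \<otimes> y"] by (auto simp: mem)
  have sub: "P \<subseteq> carrier G"
    by (auto simp: mem)
  have sinv: "x \<in> set_inv P \<longleftrightarrow> x \<in> carrier G \<and> (x, \<one>) \<in> r" for x
  proof
    assume "x \<in> set_inv P"
    then obtain p where p: "p \<in> P" "x = inv p"
      unfolding SET_INV_def by blast
    then have "p \<in> carrier G"
      using sub by blast
    then show "x \<in> carrier G \<and> (x, \<one>) \<in> r"
      using p inv_mem[of "inv p"] by simp
  next
    assume "x \<in> carrier G \<and> (x, \<one>) \<in> r"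
    then have "inv x \<in> P" "x = inv (inv x)"
      using inv_mem by simp_all
    then show "x \<in> set_inv P"
      unfolding SET_INV_def by blast
  qed
  have "P \<union> set_inv P \<union> {\<one>} = carrier G"
  proof (intro equalityI subsetI)
    fix x assume "x \<in> carrier G"
    then show "x \<in> P \<union> set_inv P \<union> {\<one>}"
      using tot_one[of x] mem[of x] sinv[of x] by blast
  qed (use sub sinv in auto)
  moreover have "P \<inter> set_inv P = {}"
    using transD[OF tr, of \<one> _ \<one>] ir by (auto simp: mem sinv irrefl_def)
  moreover have "\<one> \<notin> set_inv P"
    using ir by (auto simp: sinv irrefl_def)
  moreover have "P <#> P \<subseteq> P"
    using mult unfolding set_mult_def by auto
  ultimately show "P \<subseteq> carrier G \<and> P <#> P \<subseteq> P \<and>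
      P \<union> set_inv P \<union> {\<one>} = carrier G \<and> P \<inter> set_inv P = {} \<and> \<one> \<notin> P \<and> \<one> \<notin> set_inv P"
    using one sub by blast
next
  assume *: "P \<subseteq> carrier G \<and> P <#> P \<subseteq> P \<and>
    P \<union> set_inv P \<union> {\<one>} = carrier G \<and> P \<inter> set_inv P = {} \<and> \<one> \<notin> P \<and> \<one> \<notin> set_inv P"
  define r where "r = {(x, y). x \<in> carrier G \<and> y \<in> carrier G \<and> inv x \<otimes> y \<in> P}"
  have mult: "x \<otimes> y \<in> P" if "x \<in> P" "y \<in> P" for x y
    using * that unfolding set_mult_def by auto
  have "trans r"
  proof (rule transI)
    fix x y z assume "(x, y) \<in> r" "(y, z) \<in> r"
    then have c: "x \<in> carrier G" "y \<in> carrier G" "z \<in> carrier G"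
      and p: "inv x \<otimes> y \<in> P" "inv y \<otimes> z \<in> P"
      unfolding r_def by auto
    have "y \<otimes> (inv y \<otimes> z) = z"
      using c by (simp add: m_assoc[symmetric])
    then have "(inv x \<otimes> y) \<otimes> (inv y \<otimes> z) = inv x \<otimes> z"
      using c by (simp add: m_assoc)
    then show "(x, z) \<in> r"
      using mult[OF p] c unfolding r_def by simp
  qed
  moreover have "irrefl r"
    using * unfolding r_def irrefl_def by auto
  moreover have "total_on (carrier G) r"
  proof (rule total_onI)
    fix x y assume c: "x \<in> carrier G" "y \<in> carrier G" and ne: "x \<noteq> y"
    have "inv x \<otimes> y \<noteq> \<one>"
      using c ne by (metis inv_equality inv_inv inv_closed)
    then have "inv x \<otimes> y \<in> P \<or> inv x \<otimes> y \<in> set_inv P"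
      using * c by (metis UnE inv_closed m_closed singletonD)
    moreover have "inv y \<otimes> x \<in> P" if i: "inv x \<otimes> y \<in> set_inv P"
    proof -
      obtain p where p: "p \<in> P" "inv x \<otimes> y = inv p"
        using i unfolding SET_INV_def by auto
      have "p = inv (inv x \<otimes> y)"
        using * p by (metis inv_inv subsetD)
      also have "\<dots> = inv y \<otimes> x"
        using c by (simp add: inv_mult_group)
      finally show ?thesis
        using p by simp
    qed
    ultimately show "(x, y) \<in> r \<or> (y, x) \<in> r"
      using c unfolding r_def by auto
  qed
  moreover have "(f \<otimes> x, f \<otimes> y) \<in> r"
    if "f \<in> carrier G" "x \<in> carrier G" "y \<in> carrier G" "(x, y) \<in> r" for f x y
  proof -
    have "inv f \<otimes> (f \<otimes> y) = y"
      using that by (simp add: m_assoc[symmetric])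
    then have "inv (f \<otimes> x) \<otimes> (f \<otimes> y) = inv x \<otimes> y"
      using that by (simp add: inv_mult_group m_assoc)
    then show ?thesis
      using that unfolding r_def by simp
  qed
  moreover have "r \<subseteq> carrier G \<times> carrier G"
    unfolding r_def by auto
  ultimately have "left_ordering G r"
    unfolding left_ordering_def strict_linear_order_on_def by blast
  moreover have "positive_cone G r = P"
    using * unfolding positive_cone_def r_def by auto
  ultimately show "P \<in> LO G"
    unfolding LO_def by blast
qed

end

theory Submission
  imports Defs
begin

text \<open>
  An automorphism that maps a positive cone onto itself preserves the ordering defined by that cone,
  and hence fixes the smallest positive element whenever there is one
  (\<open>auto_fixes_smallest_positive\<close>). An automorphism acting trivially on the space of all positive
  cones therefore fixes every generator \<open>g\<^sub>i\<close>, as \<open>g\<^sub>i\<close> is intrinsically determined by \<open>P\<^sub>i\<close>. A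
  homomorphism that fixes a generating set is the identity (\<open>hom_fixes_generate\<close>), so the kernel of
  the action is trivial.

  That images of positive cones under automorphisms are positive cones (\<open>auto_image_LO\<close>) is read
  off from the algebraic description of cones in \<open>group.mem_LO_iff\<close>, all of whose conditions are
  transported by an injective and surjective homomorphism.
\<close>

lemma auto_hom: "\<phi> \<in> auto G \<Longrightarrow> \<phi> \<in> hom G G"
  by (simp add: auto_def)

lemma auto_bij: "\<phi> \<in> auto G \<Longrightarrow> bij_betw \<phi> (carrier G) (carrier G)"
  by (simp add: auto_def Bij_def)

lemma (in group) auto_group_hom: "\<phi> \<in> auto G \<Longrightarrow> group_hom G G \<phi>"
  by (simp add: auto_hom group_hom_def group_hom_axioms_def is_group)

lemma (in group_hom) set_inv_image:
  assumes "P \<subseteq> carrier G"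
  shows "set_inv\<^bsub>H\<^esub> (h ` P) = h ` (set_inv P)"
  using assms unfolding SET_INV_def image_UN by (auto simp: subset_iff)

lemma (in group) auto_image_LO:
  assumes \<phi>: "\<phi> \<in> auto G" and "P \<in> LO G"
  shows "\<phi> ` P \<in> LO G"
proof -
  interpret \<phi>: group_hom G G \<phi>
    using \<phi> by (rule auto_group_hom)
  have inj: "inj_on \<phi> (carrier G)" and surj: "\<phi> ` carrier G = carrier G"
    using auto_bij[OF \<phi>] by (auto simp: bij_betw_def)
  have P: "P \<subseteq> carrier G" "P <#> P \<subseteq> P" "P \<union> set_inv P \<union> {\<one>} = carrier G"
      "P \<inter> set_inv P = {}" "\<one> \<notin> P" "\<one> \<notin> set_inv P"
    using assms(2) by (simp_all add: mem_LO_iff)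
  have Q: "set_inv P \<subseteq> carrier G"
    using P(3) by blast
  have sinv: "set_inv (\<phi> ` P) = \<phi> ` (set_inv P)"
    using P(1) by (rule \<phi>.set_inv_image)
  have one: "\<one> \<notin> \<phi> ` S" if "S \<subseteq> carrier G" "\<one> \<notin> S" for S
    using inj_on_image_mem_iff[OF inj one_closed that(1)] that(2) by simp
  have "\<phi> ` P \<union> \<phi> ` (set_inv P) \<union> {\<one>} = \<phi> ` (P \<union> set_inv P \<union> {\<one>})"
    by (simp add: image_Un)
  then have "\<phi> ` P \<union> \<phi> ` (set_inv P) \<union> {\<one>} = carrier G"
    unfolding P(3) surj .
  moreover have "\<phi> ` P <#> \<phi> ` P = \<phi> ` (P <#> P)"
    using set_mult_hom[OF auto_hom[OF \<phi>] P(1) P(1)] by simp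
  then have "\<phi> ` P <#> \<phi> ` P \<subseteq> \<phi> ` P"
    using P(2) by auto
  moreover have "\<phi> ` P \<inter> \<phi> ` (set_inv P) = {}"
    using inj_on_image_Int[OF inj P(1) Q] P(4) by simp
  moreover have "\<phi> ` P \<subseteq> carrier G"
    using P(1) surj by blast
  ultimately show ?thesis
    unfolding mem_LO_iff sinv using one[OF P(1,5)] one[OF Q P(6)] by blast
qed

lemma carrier_AutoGroup: "carrier (AutoGroup G) = auto G"
  by (simp add: AutoGroup_def)

lemma mult_AutoGroup:
  "\<phi> \<in> auto G \<Longrightarrow> \<psi> \<in> auto G \<Longrightarrow>
    \<phi> \<otimes>\<^bsub>AutoGroup G\<^esub> \<psi> = compose (carrier G) \<phi> \<psi>"
  by (simp add: AutoGroup_def BijGroup_def auto_def)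

lemma one_AutoGroup: "\<one>\<^bsub>AutoGroup G\<^esub> = (\<lambda>x\<in>carrier G. x)"
  by (simp add: AutoGroup_def BijGroup_def)

lemma LO_subset_carrier: "P \<in> LO G \<Longrightarrow> P \<subseteq> carrier G"
  by (auto simp: LO_def positive_cone_def)

lemma (in group) LO_action_compose:
  assumes "\<phi> \<in> auto G" "\<psi> \<in> auto G"
  shows "LO_action G (compose (carrier G) \<phi> \<psi>) = compose (LO G) (LO_action G \<phi>) (LO_action G \<psi>)"
proof
  fix P
  have "compose (carrier G) \<phi> \<psi> ` P = \<phi> ` \<psi> ` P" if "P \<in> LO G"
    using LO_subset_carrier[OF that] by (force simp: compose_def)
  then show "LO_action G (compose (carrier G) \<phi> \<psi>) P
      = compose (LO G) (LO_action G \<phi>) (LO_action G \<psi>) P"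
    by (simp add: LO_action_def compose_def auto_image_LO[OF assms(2)])
qed

lemma LO_action_id: "LO_action G (\<lambda>x\<in>carrier G. x) = (\<lambda>P\<in>LO G. P)"
  unfolding LO_action_def by (rule restrict_ext) (use LO_subset_carrier in force)

text \<open>The inverse automorphism induces the inverse map on cones, because the action is compatible with
  composition and identities.\<close>

lemma (in group) LO_action_Bij:
  assumes \<phi>: "\<phi> \<in> auto G"
  shows "LO_action G \<phi> \<in> Bij (LO G)"
proof -
  define \<psi> where "\<psi> = inv\<^bsub>AutoGroup G\<^esub> \<phi>"
  interpret A: group "AutoGroup G"
    by (rule AutoGroup)
  have \<psi>: "\<psi> \<in> auto G"
    using \<phi> A.inv_closed unfolding \<psi>_def carrier_AutoGroup by blast
  have "compose (carrier G) \<psi> \<phi> = (\<lambda>x\<in>carrier G. x)"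
    "compose (carrier G) \<phi> \<psi> = (\<lambda>x\<in>carrier G. x)"
    using A.l_inv[of \<phi>] A.r_inv[of \<phi>] mult_AutoGroup[OF \<phi> \<psi>] mult_AutoGroup[OF \<psi> \<phi>] \<phi>
    unfolding carrier_AutoGroup one_AutoGroup \<psi>_def[symmetric] by auto
  then have c: "compose (LO G) (LO_action G \<psi>) (LO_action G \<phi>) = (\<lambda>P\<in>LO G. P)"
    "compose (LO G) (LO_action G \<phi>) (LO_action G \<psi>) = (\<lambda>P\<in>LO G. P)"
    using LO_action_compose \<phi> \<psi> LO_action_id by metis+
  have "bij_betw (LO_action G \<phi>) (LO G) (LO G)"
  proof (rule bij_betwI[where g = "LO_action G \<psi>"])
    show "LO_action G \<phi> \<in> LO G \<rightarrow> LO G" "LO_action G \<psi> \<in> LO G \<rightarrow> LO G"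
      using \<phi> \<psi> by (auto simp: LO_action_def auto_image_LO)
    show "LO_action G \<psi> (LO_action G \<phi> P) = P" if "P \<in> LO G" for P
      using fun_cong[OF c(1), of P] that by (simp add: compose_def)
    show "LO_action G \<phi> (LO_action G \<psi> P) = P" if "P \<in> LO G" for P
      using fun_cong[OF c(2), of P] that by (simp add: compose_def)
  qed
  then show ?thesis
    by (simp add: Bij_def LO_action_def)
qed

lemma (in group) LO_action_group_action: "group_action (AutoGroup G) (LO G) (LO_action G)"
proof -
  have "LO_action G \<in> hom (AutoGroup G) (BijGroup (LO G))"
    by (auto simp: hom_def carrier_AutoGroup mult_AutoGroup LO_action_Bij LO_action_compose
        BijGroup_def)
  then show ?thesis
    by (simp add: group_action_def group_hom_def group_hom_axioms_def AutoGroup group_BijGroup)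
qed

lemma (in group) left_ordering_iff_cone:
  assumes r: "left_ordering G r" and x: "x \<in> carrier G" and y: "y \<in> carrier G"
  shows "(x, y) \<in> r \<longleftrightarrow> inv x \<otimes> y \<in> positive_cone G r"
proof -
  have left: "(f \<otimes> a, f \<otimes> b) \<in> r"
    if "f \<in> carrier G" "a \<in> carrier G" "b \<in> carrier G" "(a, b) \<in> r" for f a b
    using r that unfolding left_ordering_def by blast
  have "x \<otimes> (inv x \<otimes> y) = y"
    using x y by (simp add: m_assoc[symmetric])
  then show ?thesis
    using left[of "inv x" x y] left[of x \<one> "inv x \<otimes> y"] x y
    by (auto simp: positive_cone_def)
qed

text \<open>The ordering can be recovered from its cone, as \<open>x < y\<close> means \<open>x\<^sup>-\<^sup>1 y \<in> P\<close>; so an automorphism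
  stabilizing the cone is an automorphism of the ordering.\<close>

lemma (in group) auto_preserves_ordering:
  assumes \<phi>: "\<phi> \<in> auto G" and r: "left_ordering G r"
    and stab: "\<phi> ` positive_cone G r = positive_cone G r" and xy: "(x, y) \<in> r"
  shows "(\<phi> x, \<phi> y) \<in> r"
proof -
  interpret \<phi>: group_hom G G \<phi>
    using \<phi> by (rule auto_group_hom)
  have c: "x \<in> carrier G" "y \<in> carrier G"
    using r xy by (auto simp: left_ordering_def)
  have "\<phi> (inv x \<otimes> y) \<in> positive_cone G r"
    using left_ordering_iff_cone[OF r c] xy stab by blast
  then show ?thesis
    using left_ordering_iff_cone[OF r, of "\<phi> x" "\<phi> y"] c by simp
qed

text \<open>The image of a smallest positive element is again positive and lies below every element of
  the image of the cone, which is the cone itself; by uniqueness of minima it is the same element.\<close>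

lemma (in group) auto_fixes_smallest_positive:
  assumes \<phi>: "\<phi> \<in> auto G" and r: "left_ordering G r"
    and stab: "\<phi> ` positive_cone G r = positive_cone G r" and s: "smallest_positive G r s"
  shows "\<phi> s = s"
proof (rule ccontr)
  assume ne: "\<phi> s \<noteq> s"
  have least: "s \<in> positive_cone G r" "h \<in> positive_cone G r \<Longrightarrow> h = s \<or> (s, h) \<in> r" for h
    using s by (auto simp: smallest_positive_def)
  (* Minimality of s, applied to its image and then to its preimage h, puts \<phi> s on both sides of s. *)
  have "(s, \<phi> s) \<in> r"
    using least(1) least(2)[of "\<phi> s"] stab ne by blast
  moreover obtain h where h: "h \<in> positive_cone G r" "\<phi> h = s"
    using least(1) stab by (metis imageE)
  then have "(s, h) \<in> r"
    using least(2)[of h] ne by auto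
  then have "(\<phi> s, s) \<in> r"
    using auto_preserves_ordering[OF \<phi> r stab] h(2) by blast
  ultimately show False
    using r unfolding left_ordering_def strict_linear_order_on_def
    by (meson irreflD transD)
qed

lemma (in group) hom_fixes_generate:
  assumes "\<phi> \<in> hom G G" and S: "S \<subseteq> carrier G" and fix_S: "\<And>s. s \<in> S \<Longrightarrow> \<phi> s = s"
    and "x \<in> generate G S"
  shows "\<phi> x = x"
proof -
  interpret \<phi>: group_hom G G \<phi>
    using assms(1) by (simp add: group_hom_def group_hom_axioms_def is_group)
  show ?thesis
    using assms(4)
  proof (induction rule: generate.induct)
    case (inv s)
    then show ?case
      using \<phi>.hom_inv[of s] fix_S[of s] subsetD[OF S, of s] by metis
  next
    case (eng x y)
    then show ?case
      using \<phi>.hom_mult[of x y] generate_in_carrier[OF S] by metis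
  qed (use fix_S \<phi>.hom_one in blast)+
qed

text \<open>Different generators may be smallest positive elements of different orderings: each ordering
  only serves to pin down its own generator.\<close>

lemma (in group) auto_eq_id_if_stabilizes_discrete_cones:
  assumes \<phi>: "\<phi> \<in> auto G" and S: "S \<subseteq> carrier G" and gen: "generate G S = carrier G"
    and discrete: "\<And>s. s \<in> S \<Longrightarrow> \<exists>r. left_ordering G r \<and> smallest_positive G r s \<and>
      \<phi> ` positive_cone G r = positive_cone G r"
  shows "\<phi> = (\<lambda>x\<in>carrier G. x)"
proof (rule extensionalityI[of _ "carrier G"])
  show "\<phi> \<in> extensional (carrier G)"
    using \<phi> by (simp add: auto_def Bij_def)
  fix x assume x: "x \<in> carrier G"
  have fix_S: "\<phi> s = s" if "s \<in> S" for s
    using discrete[OF that] auto_fixes_smallest_positive[OF \<phi>] by metis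
  have "\<phi> x = x"
    by (rule hom_fixes_generate[OF auto_hom[OF \<phi>] S fix_S]) (simp_all add: gen x)
  then show "\<phi> x = (\<lambda>x\<in>carrier G. x) x"
    using x by simp
qed (rule restrict_extensional)

theorem proposition3p1:
  fixes G (structure) and I :: "'i set" and g :: "'i \<Rightarrow> 'a"
  assumes "group G"
    and "left_orderable G"
    and "g ` I \<subseteq> carrier G"
    and "generate G (g ` I) = carrier G"
    and "\<forall>i\<in>I. \<exists>P\<in>LO G. \<exists>r. discrete_left_ordering G r \<and>
           P = positive_cone G r \<and> smallest_positive G r (g i)"
  shows "faithful_action (AutoGroup G) (LO G) (LO_action G)"
proof -
  have G: "group G"
    by fact
  have action: "group_action (AutoGroup G) (LO G) (LO_action G)"
    using G by (rule group.LO_action_group_action)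
  have "\<phi> = \<one>\<^bsub>AutoGroup G\<^esub>"
    if \<phi>: "\<phi> \<in> carrier (AutoGroup G)" and trivial: "LO_action G \<phi> = \<one>\<^bsub>BijGroup (LO G)\<^esub>" for \<phi>
  proof -
    have stab: "\<phi> ` P = P" if P: "P \<in> LO G" for P
    proof -
      have "\<phi> ` P = LO_action G \<phi> P"
        using P by (simp add: LO_action_def)
      also have "\<dots> = P"
        unfolding trivial using P by (simp add: BijGroup_def)
      finally show ?thesis .
    qed
    have "\<exists>r. left_ordering G r \<and> smallest_positive G r s \<and>
        \<phi> ` positive_cone G r = positive_cone G r" if s: "s \<in> g ` I" for s
    proof -
      obtain i where "i \<in> I" "s = g i"
        using s by (rule imageE)
      then obtain P r where "P \<in> LO G" "discrete_left_ordering G r" "P = positive_cone G r"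
          "smallest_positive G r s"
        using assms(5) by blast
      then show ?thesis
        using stab[of P] unfolding discrete_left_ordering_def by (intro exI[of _ r]) simp
    qed
    with \<phi> show ?thesis
      unfolding carrier_AutoGroup one_AutoGroup
      by (intro group.auto_eq_id_if_stabilizes_discrete_cones[OF G _ assms(3,4)])
  qed
  then have "inj_on (LO_action G) (carrier (AutoGroup G))"
    unfolding group_hom.inj_on_one_iff[OF group_action.group_hom[OF action]] by simp
  then show ?thesis
    using action by (simp add: faithful_action_def faithful_action_axioms_def)
qed

end
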